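(* Consider the two-agent, two-alternative social choice environment described in the context. Let $(p,t)$ be a BIC mechanism and $(\tilde p,\tilde t)$ a deterministic DIC mechanism. Then $(p,t)$ is payoff-equivalent to $(\tilde p,\tilde t)$ if and only if they are ex-post equivalent.
   Context: There are two agents $i\in\{1,2\}$ and two alternatives $k\in\{1,2\}$. Agent $i$ privately observes a type $\theta_i\in\Theta_i$, where $\Theta_i\subset\mathbb R$ is a compact interval; types are independent and $\theta_i$ follows a continuous distribution $G_i$. Agent $i$'s utility from alternative $k$ and payment $t_i\in\mathbb R$ is $u_i^k(\theta_i,t_i)=a_i^k\theta_i+c_i^k-t_i$, with constants $a_i^k,c_i^k\in\mathbb R$ and $a_i^1\ne a_i^2$. A (direct) mechanism is a measurable map $(p,t):\Theta_1\times\Theta_2\to\Delta(\{1,2\})\times\mathbb R^2$ giving the probabilities of each alternative and each agent's transfer at every type report. It is Bayesian incentive compatible (BIC) if truthful reporting is a Bayes–Nash equilibrium; dominant strategy incentive compatible (DIC) if truthful reporting is a dominant strategy equilibrium; deterministic if $p(\theta)$ is a deterministic allocation for all $\theta$. Two BIC mechanisms are payoff-equivalent if they yield the same ex-ante expected surplus and the same interim expected utilities for all agents (and all types). Two payoff-equivalent mechanisms are ex-post equivalent if they implement the same ex-post allocation probabilities for all type profiles, up to measure zero. *)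

theory Defs
  imports "HOL-Probability.Probability"
begin

type_synonym agent = 2
type_synonym alternative = 2

text \<open>A report profile is a pair whose first component belongs to agent 1 and whose second
  component belongs to agent 2.\<close>

type_synonym type_profile = "real \<times> real"
type_synonym allocation_rule = "type_profile \<Rightarrow> alternative pmf"
type_synonym transfer_rule = "type_profile \<Rightarrow> agent \<Rightarrow> real"

definition opponent :: "agent \<Rightarrow> agent" where
  "opponent i = (if i = 1 then 2 else 1)"

definition profile :: "agent \<Rightarrow> real \<Rightarrow> real \<Rightarrow> type_profile" where
  "profile i own other = (if i = 1 then (own, other) else (other, own))"

definition type_of :: "type_profile \<Rightarrow> agent \<Rightarrow> real" where
  "type_of \<theta> i = (if i = 1 then fst \<theta> else snd \<theta>)"

text \<open>\<open>G i\<close> is a distribution on the whole real line that gives mass one to the type space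
  \<open>\<Theta> i\<close>. Mechanisms are only defined on \<open>\<Theta> 1 \<times> \<Theta> 2\<close>, so all measurability
  conditions and integrals refer to the restriction of \<open>G i\<close> to \<open>\<Theta> i\<close>.\<close>

definition type_dist :: "(agent \<Rightarrow> real set) \<Rightarrow> (agent \<Rightarrow> real measure) \<Rightarrow> agent \<Rightarrow> real measure" where
  "type_dist \<Theta> G i = restrict_space (G i) (\<Theta> i)"

definition profile_dist :: "(agent \<Rightarrow> real set) \<Rightarrow> (agent \<Rightarrow> real measure) \<Rightarrow> type_profile measure" where
  "profile_dist \<Theta> G = type_dist \<Theta> G 1 \<Otimes>\<^sub>M type_dist \<Theta> G 2"

definition mechanism ::
  "(agent \<Rightarrow> real set) \<Rightarrow> (agent \<Rightarrow> real measure) \<Rightarrow> allocation_rule \<Rightarrow> transfer_rule \<Rightarrow> bool" where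
  "mechanism \<Theta> G p t \<longleftrightarrow>
     (\<forall>k. (\<lambda>\<theta>. pmf (p \<theta>) k) \<in> borel_measurable (profile_dist \<Theta> G)) \<and>
     (\<forall>i. (\<lambda>\<theta>. t \<theta> i) \<in> borel_measurable (profile_dist \<Theta> G))"

definition utility ::
  "(agent \<Rightarrow> alternative \<Rightarrow> real) \<Rightarrow> (agent \<Rightarrow> alternative \<Rightarrow> real) \<Rightarrow>
   agent \<Rightarrow> alternative \<Rightarrow> real \<Rightarrow> real \<Rightarrow> real" where
  "utility a c i k x s = a i k * x + c i k - s"

text \<open>Expected utility, over the lottery between the alternatives, of agent \<open>i\<close> with true type
  \<open>x\<close> when the reported profile is \<open>\<theta>\<close>.\<close>

definition ex_post_utility ::
  "(agent \<Rightarrow> alternative \<Rightarrow> real) \<Rightarrow> (agent \<Rightarrow> alternative \<Rightarrow> real) \<Rightarrow>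
   allocation_rule \<Rightarrow> transfer_rule \<Rightarrow> agent \<Rightarrow> real \<Rightarrow> type_profile \<Rightarrow> real" where
  "ex_post_utility a c p t i x \<theta> = (\<Sum>k\<in>UNIV. pmf (p \<theta>) k * utility a c i k x (t \<theta> i))"

text \<open>In the next two definitions agent \<open>i\<close> has true type \<open>x\<close> and reports \<open>r\<close>, and the opponent
  reports truthfully. The Bochner integral of a non-integrable function is 0, so the existence of
  an interim expected utility is a separate condition, imposed wherever interim utilities are
  compared.\<close>

definition interim_utility_exists ::
  "(agent \<Rightarrow> real set) \<Rightarrow> (agent \<Rightarrow> real measure) \<Rightarrow>
   (agent \<Rightarrow> alternative \<Rightarrow> real) \<Rightarrow> (agent \<Rightarrow> alternative \<Rightarrow> real) \<Rightarrow>
   allocation_rule \<Rightarrow> transfer_rule \<Rightarrow> agent \<Rightarrow> real \<Rightarrow> real \<Rightarrow> bool" where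
  "interim_utility_exists \<Theta> G a c p t i x r \<longleftrightarrow>
     integrable (type_dist \<Theta> G (opponent i)) (\<lambda>y. ex_post_utility a c p t i x (profile i r y))"

definition interim_utility ::
  "(agent \<Rightarrow> real set) \<Rightarrow> (agent \<Rightarrow> real measure) \<Rightarrow>
   (agent \<Rightarrow> alternative \<Rightarrow> real) \<Rightarrow> (agent \<Rightarrow> alternative \<Rightarrow> real) \<Rightarrow>
   allocation_rule \<Rightarrow> transfer_rule \<Rightarrow> agent \<Rightarrow> real \<Rightarrow> real \<Rightarrow> real" where
  "interim_utility \<Theta> G a c p t i x r =
     (\<integral>y. ex_post_utility a c p t i x (profile i r y) \<partial>type_dist \<Theta> G (opponent i))"

definition BIC ::
  "(agent \<Rightarrow> real set) \<Rightarrow> (agent \<Rightarrow> real measure) \<Rightarrow>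
   (agent \<Rightarrow> alternative \<Rightarrow> real) \<Rightarrow> (agent \<Rightarrow> alternative \<Rightarrow> real) \<Rightarrow>
   allocation_rule \<Rightarrow> transfer_rule \<Rightarrow> bool" where
  "BIC \<Theta> G a c p t \<longleftrightarrow>
     (\<forall>i. \<forall>x\<in>\<Theta> i. \<forall>r\<in>\<Theta> i.
        interim_utility_exists \<Theta> G a c p t i x r \<and>
        interim_utility \<Theta> G a c p t i x r \<le> interim_utility \<Theta> G a c p t i x x)"

definition DIC ::
  "(agent \<Rightarrow> real set) \<Rightarrow>
   (agent \<Rightarrow> alternative \<Rightarrow> real) \<Rightarrow> (agent \<Rightarrow> alternative \<Rightarrow> real) \<Rightarrow>
   allocation_rule \<Rightarrow> transfer_rule \<Rightarrow> bool" where
  "DIC \<Theta> a c p t \<longleftrightarrow>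
     (\<forall>i. \<forall>x\<in>\<Theta> i. \<forall>r\<in>\<Theta> i. \<forall>y\<in>\<Theta> (opponent i).
        ex_post_utility a c p t i x (profile i r y) \<le> ex_post_utility a c p t i x (profile i x y))"

definition deterministic :: "(agent \<Rightarrow> real set) \<Rightarrow> allocation_rule \<Rightarrow> bool" where
  "deterministic \<Theta> p \<longleftrightarrow> (\<forall>\<theta>\<in>\<Theta> 1 \<times> \<Theta> 2. \<exists>k. p \<theta> = return_pmf k)"

text \<open>Surplus is the sum of the agents' gross utilities, i.e. transfers between the agents and the
  designer cancel.\<close>

definition expected_surplus ::
  "(agent \<Rightarrow> real set) \<Rightarrow> (agent \<Rightarrow> real measure) \<Rightarrow>
   (agent \<Rightarrow> alternative \<Rightarrow> real) \<Rightarrow> (agent \<Rightarrow> alternative \<Rightarrow> real) \<Rightarrow>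
   allocation_rule \<Rightarrow> real" where
  "expected_surplus \<Theta> G a c p =
     (\<integral>\<theta>. (\<Sum>i\<in>UNIV. \<Sum>k\<in>UNIV. pmf (p \<theta>) k * utility a c i k (type_of \<theta> i) 0)
        \<partial>profile_dist \<Theta> G)"

definition payoff_equivalent ::
  "(agent \<Rightarrow> real set) \<Rightarrow> (agent \<Rightarrow> real measure) \<Rightarrow>
   (agent \<Rightarrow> alternative \<Rightarrow> real) \<Rightarrow> (agent \<Rightarrow> alternative \<Rightarrow> real) \<Rightarrow>
   allocation_rule \<Rightarrow> transfer_rule \<Rightarrow> allocation_rule \<Rightarrow> transfer_rule \<Rightarrow> bool" where
  "payoff_equivalent \<Theta> G a c p t p' t' \<longleftrightarrow>
     expected_surplus \<Theta> G a c p = expected_surplus \<Theta> G a c p' \<and>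
     (\<forall>i. \<forall>x\<in>\<Theta> i.
        interim_utility_exists \<Theta> G a c p t i x x \<and>
        interim_utility_exists \<Theta> G a c p' t' i x x \<and>
        interim_utility \<Theta> G a c p t i x x = interim_utility \<Theta> G a c p' t' i x x)"

text \<open>Ex-post equivalence is a refinement of payoff equivalence: equal allocation probabilities
  alone leave the transfers undetermined.\<close>

definition ex_post_equivalent ::
  "(agent \<Rightarrow> real set) \<Rightarrow> (agent \<Rightarrow> real measure) \<Rightarrow>
   (agent \<Rightarrow> alternative \<Rightarrow> real) \<Rightarrow> (agent \<Rightarrow> alternative \<Rightarrow> real) \<Rightarrow>
   allocation_rule \<Rightarrow> transfer_rule \<Rightarrow> allocation_rule \<Rightarrow> transfer_rule \<Rightarrow> bool" where
  "ex_post_equivalent \<Theta> G a c p t p' t' \<longleftrightarrow>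
     payoff_equivalent \<Theta> G a c p t p' t' \<and>
     (AE \<theta> in profile_dist \<Theta> G. \<forall>k. pmf (p \<theta>) k = pmf (p' \<theta>) k)"

end

theory Submission
  imports Defs
begin

text \<open>An agent's truthful interim utility is a convex function of the type, with the interim
  allocation probabilities, up to an affine change, as a subgradient. Payoff-equivalent mechanisms
  therefore have equal interim allocations off a countable, hence null, set. A deterministic DIC
  allocation is, for each fixed type of agent 1, a threshold rule in the type of agent 2, and such
  a rule \<open>q'\<close> is almost everywhere the only \<open>[0, 1]\<close>-valued allocation with its marginals: for a
  separable score that is nonnegative where \<open>q' = 1\<close>, nonpositive where \<open>q' = 0\<close> and almost
  everywhere nonzero, the score times \<open>q' - q\<close> is nonnegative with integral zero.\<close>

section \<open>Two subgradient selections of one convex function\<close>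

text \<open>Wherever \<open>S\<close> and \<open>S'\<close> disagree, a rational lies strictly
  between them. Subgradients of the same \<open>V\<close> increase with the point even across the
  two selections, so these gaps are disjoint and the chosen rationals are distinct.\<close>

lemma countable_common_subgradients_differ:
  fixes V S S' :: "real \<Rightarrow> real"
  assumes S: "\<And>x r. x \<in> T \<Longrightarrow> r \<in> T \<Longrightarrow> V r + (x - r) * S r \<le> V x"
    and S': "\<And>x r. x \<in> T \<Longrightarrow> r \<in> T \<Longrightarrow> V r + (x - r) * S' r \<le> V x"
  shows "countable {x \<in> T. S x \<noteq> S' x}"
proof -
  let ?D = "{x \<in> T. S x \<noteq> S' x}"
  \<comment> \<open>Add the inequality for \<open>A\<close> based at \<open>x\<close> and the one
    for \<open>B\<close> based at \<open>y\<close>: the values of \<open>V\<close> cancel.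
    \<open>A\<close> and \<open>B\<close> will range over all four pairs from \<open>S\<close> and
    \<open>S'\<close>.\<close>
  have le: "A x \<le> B y"
    if "x \<in> T" "y \<in> T" "x < y"
      and A: "\<And>x r. x \<in> T \<Longrightarrow> r \<in> T \<Longrightarrow> V r + (x - r) * A r \<le> V x"
      and B: "\<And>x r. x \<in> T \<Longrightarrow> r \<in> T \<Longrightarrow> V r + (x - r) * B r \<le> V x" for A B x y
  proof -
    have "(y - x) * A x \<le> (y - x) * B y"
      using A[of y x] B[of x y] that(1,2) by (simp add: algebra_simps)
    then show ?thesis using \<open>x < y\<close> by simp
  qed
  have "\<exists>s. min (S x) (S' x) < real_of_rat s \<and> real_of_rat s < max (S x) (S' x)" if "x \<in> ?D" for x
    using that by (intro of_rat_dense) auto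
  then obtain s where s: "\<And>x. x \<in> ?D \<Longrightarrow>
      min (S x) (S' x) < real_of_rat (s x) \<and> real_of_rat (s x) < max (S x) (S' x)"
    by metis
  have less: "real_of_rat (s x) < real_of_rat (s y)" if "x \<in> ?D" "y \<in> ?D" "x < y" for x y
  proof -
    have "max (S x) (S' x) \<le> min (S y) (S' y)"
      using le[of x y S S] le[of x y S S'] le[of x y S' S] le[of x y S' S'] S S' that by auto
    then show ?thesis using s[OF that(1)] s[OF that(2)] by linarith
  qed
  have "inj_on s ?D"
  proof (rule inj_onI)
    fix x y assume "x \<in> ?D" "y \<in> ?D" "s x = s y"
    then show "x = y"
      using less[of x y] less[of y x] by (cases x y rule: linorder_cases) auto
  qed
  then show ?thesis by (intro countable_image_inj_on[of s]) simp_all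
qed

section \<open>Uniqueness of a threshold rule with given marginals\<close>

text \<open>The open interval between \<open>y\<close> and \<open>y'\<close> lies in
  \<open>T\<close> and in the difference of the two upper sets, and it has positive length. This
  makes \<open>h\<close> injective on \<open>T\<close> in the next lemma.\<close>

lemma strict_antimono_upper_measure:
  fixes T :: "real set"
  assumes "compact T" "is_interval T" "y \<in> T" "y' \<in> T" "\<sigma> * y < \<sigma> * y'"
  shows "measure lborel {z \<in> T. \<sigma> * y' < \<sigma> * z} < measure lborel {z \<in> T. \<sigma> * y < \<sigma> * z}"
proof -
  let ?A = "\<lambda>y. {z \<in> T. \<sigma> * y < \<sigma> * z}" and ?I = "{min y y'<..<max y y'}"
  have [measurable]: "T \<in> sets borel"
    using assms by (simp add: borel_compact)
  have fm: "?A y \<in> fmeasurable lborel" for y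
    using fmeasurable_compact[OF assms(1)]
    by (rule fmeasurableI2) auto
  have ne: "y \<noteq> y'" using assms(5) by auto
  have sub: "?I \<subseteq> T"
    using mem_is_interval_1_I[OF assms(2,3,4)] mem_is_interval_1_I[OF assms(2,4,3)]
    by (force simp: min_def max_def split: if_splits)
  \<comment> \<open>The sign of \<open>\<sigma>\<close> decides which of \<open>y\<close> and
    \<open>y'\<close> is the left endpoint, hence the \<open>min\<close> and \<open>max\<close> in
    \<open>?I\<close>.\<close>
  have "z \<in> ?A y - ?A y'" if "z \<in> ?I" for z
  proof -
    have "\<sigma> * y < \<sigma> * z \<and> \<sigma> * z < \<sigma> * y'"
      using assms(5) that
      by (cases "\<sigma> > 0") (auto simp: mult_less_cancel_left min_def max_def split: if_splits)
    then show ?thesis using sub that by auto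
  qed
  then have I: "?I \<subseteq> ?A y - ?A y'" by blast
  have "0 < measure lborel ?I"
    using ne by (simp add: min_def max_def)
  also have "\<dots> \<le> measure lborel (?A y - ?A y')"
    by (rule measure_mono_fmeasurable[OF I]) (auto intro!: fmeasurable_Diff fm)
  also have "\<dots> = measure lborel (?A y) - measure lborel (?A y')"
    using assms(5) by (intro measurable_measure_Diff fm) auto
  finally show ?thesis by simp
qed

text \<open>The score is \<open>f x - h y\<close>: if the threshold at \<open>x\<close> is \<open>b\<close>, then \<open>f x\<close> is the length of the
  upper set (in the order induced by \<open>\<sigma>\<close>) of \<open>b\<close> in \<open>T\<close>, and \<open>h y\<close> is that of \<open>y\<close>. Lebesgue
  measure is used here instead of \<open>N\<close> because it makes \<open>h\<close> injective.\<close>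

lemma threshold_rule_determined_by_marginals:
  fixes q q' :: "'a \<times> real \<Rightarrow> real" and \<sigma> :: real
  assumes M: "prob_space M" and N: "prob_space N"
    and T: "compact T" "is_interval T" and setsN: "sets N = sets (restrict_space borel T)"
    and null: "\<And>y. y \<in> T \<Longrightarrow> emeasure N {y} = 0"
    and q[measurable]: "q \<in> borel_measurable (M \<Otimes>\<^sub>M N)" and q_bounds: "\<And>\<theta>. 0 \<le> q \<theta> \<and> q \<theta> \<le> 1"
    and q'[measurable]: "q' \<in> borel_measurable (M \<Otimes>\<^sub>M N)"
    and q'_01: "\<And>x y. x \<in> space M \<Longrightarrow> y \<in> T \<Longrightarrow> q' (x, y) \<in> {0, 1}"
    and mono: "\<And>x y z. x \<in> space M \<Longrightarrow> y \<in> T \<Longrightarrow> z \<in> T \<Longrightarrow> \<sigma> * y < \<sigma> * z \<Longrightarrow> q' (x, y) \<le> q' (x, z)"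
    and \<sigma>: "\<sigma> \<noteq> 0"
    and margM: "AE x in M. (\<integral>y. q (x, y) \<partial>N) = (\<integral>y. q' (x, y) \<partial>N)"
    and margN: "AE y in N. (\<integral>x. q (x, y) \<partial>M) = (\<integral>x. q' (x, y) \<partial>M)"
  shows "AE \<theta> in M \<Otimes>\<^sub>M N. q \<theta> = q' \<theta>"
proof -
  interpret M: prob_space M by fact
  interpret N: prob_space N by fact
  interpret MN: pair_prob_space M N ..
  define L where "L = restrict_space lborel T"
  have [measurable]: "T \<in> sets borel"
    using T by (simp add: borel_compact)
  have spaceN: "space N = T"
    using sets_eq_imp_space_eq[OF setsN] by (simp add: space_restrict_space)
  have spaceL: "space L = T" by (simp add: L_def space_restrict_space)
  have setsL: "sets L = sets N" by (simp add: L_def setsN sets_restrict_space)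
  have [measurable]: "(\<lambda>y. y) \<in> borel_measurable N"
    by (subst measurable_cong_sets[OF setsN refl]) (auto intro: measurable_restrict_space1)
  have [measurable]: "(\<lambda>y. y) \<in> borel_measurable L"
    unfolding L_def by (auto intro: measurable_restrict_space1)
  interpret L: finite_measure L
    using emeasure_compact_finite[OF T(1)]
    by (intro finite_measureI) (auto simp: L_def emeasure_restrict_space space_restrict_space)
  have q'_bounds: "0 \<le> q' \<theta> \<and> q' \<theta> \<le> 1" if "\<theta> \<in> space (M \<Otimes>\<^sub>M N)" for \<theta>
    using q'_01[of "fst \<theta>" "snd \<theta>"] that by (auto simp: space_pair_measure spaceN)
  define f where "f x = (\<integral>z. q' (x, z) \<partial>L)" for x
  define u where "u y z = (indicator {z. \<sigma> * y < \<sigma> * z} z :: real)" for y z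
  define h where "h y = (\<integral>z. u y z \<partial>L)" for y
  have [measurable]: "q' \<in> borel_measurable (M \<Otimes>\<^sub>M L)"
    using q' measurable_cong_sets[OF sets_pair_measure_cong[OF refl setsL] refl] by blast
  have [measurable]: "f \<in> borel_measurable M"
    unfolding f_def by measurable
  have [measurable]: "case_prod u \<in> borel_measurable (N \<Otimes>\<^sub>M L)"
    unfolding u_def indicator_def by measurable
  have [measurable]: "h \<in> borel_measurable N"
    unfolding h_def by measurable
  have intq': "integrable L (\<lambda>z. q' (x, z))" if "x \<in> space M" for x
    using that q'_bounds
    by (intro L.integrable_const_bound[of _ 1]) (auto simp: space_pair_measure spaceN spaceL)
  have intu: "integrable L (u y)" if "y \<in> T" for y
    using that measurable_compose[OF measurable_Pair1' \<open>case_prod u \<in> _\<close>, of y]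
    by (intro L.integrable_const_bound[of _ 1]) (auto simp: spaceN u_def)
  have diff: "f x - h y = (\<integral>z. q' (x, z) - u y z \<partial>L)" if "x \<in> space M" "y \<in> T" for x y
    unfolding f_def h_def using intq' intu that by simp
  \<comment> \<open>If \<open>q' (x, y) = 1\<close>, monotonicity makes the slice
    \<open>q' (x, _)\<close> equal to 1 on the upper set of \<open>y\<close>, so it dominates
    \<open>u y\<close>; if \<open>q' (x, y) = 0\<close>, the slice vanishes off that upper set and
    is dominated by \<open>u y\<close>. Integrating gives the sign of the score, and the bounds on
    \<open>q\<close> give the same sign to \<open>q' - q\<close>.\<close>
  have nonneg: "0 \<le> (q' (x, y) - q (x, y)) * (f x - h y)" if xy: "x \<in> space M" "y \<in> T" for x y
  proof (cases "q' (x, y) = 1")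
    case True
    have "0 \<le> f x - h y"
      unfolding diff[OF xy]
    proof (rule integral_nonneg_AE, rule AE_I2)
      fix z assume "z \<in> space L"
      then show "0 \<le> q' (x, z) - u y z"
        using mono[of x y z] q'_01[of x z] xy True by (auto simp: spaceL u_def indicator_def)
    qed
    then show ?thesis using True q_bounds by simp
  next
    case False
    then have 0: "q' (x, y) = 0" using q'_01 xy by blast
    have "0 \<le> (\<integral>z. u y z - q' (x, z) \<partial>L)"
    proof (rule integral_nonneg_AE, rule AE_I2)
      fix z assume z: "z \<in> space L"
      have "q' (x, z) = 0" if "\<not> \<sigma> * y < \<sigma> * z"
      proof (cases "z = y")
        case False
        then have "\<sigma> * z < \<sigma> * y" using \<sigma> that by (metis linorder_neqE_linordered_idom mult_cancel_left)
        then show ?thesis using mono[of x z y] q'_01[of x z] xy 0 z by (auto simp: spaceL)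
      qed (use 0 in simp)
      then show "0 \<le> u y z - q' (x, z)"
        using q'_01[of x z] xy z by (auto simp: spaceL u_def indicator_def)
    qed
    also have "\<dots> = - (f x - h y)"
      using intq' intu xy by (simp add: f_def h_def)
    finally show ?thesis using 0 q_bounds by (simp add: mult_nonneg_nonpos)
  qed
  let ?m = "measure L (space L)"
  have f_bound: "\<bar>f x\<bar> \<le> ?m" if "x \<in> space M" for x
  proof -
    have "\<bar>f x\<bar> \<le> (\<integral>z. \<bar>q' (x, z)\<bar> \<partial>L)"
      unfolding f_def by (rule integral_abs_bound)
    also have "\<dots> \<le> (\<integral>z. 1 \<partial>L)"
      using q'_01 that intq'
      by (intro integral_mono) (auto simp: spaceL intro!: integrable_abs, fastforce)
    finally show ?thesis by simp
  qed
  have h_eq: "h y = measure lborel {z \<in> T. \<sigma> * y < \<sigma> * z}" for y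
  proof -
    have "h y = measure L ({z. \<sigma> * y < \<sigma> * z} \<inter> space L)"
      unfolding h_def u_def by simp
    also have "\<dots> = measure lborel {z \<in> T. \<sigma> * y < \<sigma> * z}"
      by (simp add: L_def measure_restrict_space space_restrict_space Int_def conj_commute)
    finally show ?thesis .
  qed
  have h_bound: "\<bar>h y\<bar> \<le> ?m" if "y \<in> T" for y
  proof -
    have "h y = measure L ({z. \<sigma> * y < \<sigma> * z} \<inter> space L)"
      unfolding h_def u_def by simp
    also have "\<dots> \<le> ?m" by (rule L.bounded_measure)
    finally show ?thesis by (simp add: h_eq)
  qed
  define g where "g \<theta> = q' \<theta> - q \<theta>" for \<theta>
  have [measurable]: "g \<in> borel_measurable (M \<Otimes>\<^sub>M N)" unfolding g_def by measurable
  have g_bound: "\<bar>g \<theta>\<bar> \<le> 1" if "\<theta> \<in> space (M \<Otimes>\<^sub>M N)" for \<theta>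
    using q_bounds[of \<theta>] q'_bounds[OF that] by (auto simp: g_def)
  have gf: "integrable (M \<Otimes>\<^sub>M N) (\<lambda>\<theta>. g \<theta> * f (fst \<theta>))"
    using mult_mono[OF g_bound f_bound]
    by (intro MN.P.integrable_const_bound[of _ ?m] AE_I2) (auto simp: abs_mult space_pair_measure)
  have gh: "integrable (M \<Otimes>\<^sub>M N) (\<lambda>\<theta>. g \<theta> * h (snd \<theta>))"
    using mult_mono[OF g_bound h_bound]
    by (intro MN.P.integrable_const_bound[of _ ?m] AE_I2) (auto simp: abs_mult space_pair_measure spaceN)
  have gM: "AE x in M. (\<integral>y. g (x, y) \<partial>N) = 0"
    using margM
  proof (rule AE_mp, intro AE_I2 impI)
    fix x assume x: "x \<in> space M" and eq: "(\<integral>y. q (x, y) \<partial>N) = (\<integral>y. q' (x, y) \<partial>N)"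
    have "integrable N (\<lambda>y. q (x, y))" "integrable N (\<lambda>y. q' (x, y))"
      using x q_bounds q'_bounds by (auto intro!: N.integrable_const_bound[of _ 1] simp: space_pair_measure)
    then show "(\<integral>y. g (x, y) \<partial>N) = 0" using eq by (simp add: g_def)
  qed
  have gN: "AE y in N. (\<integral>x. g (x, y) \<partial>M) = 0"
    using margN
  proof (rule AE_mp, intro AE_I2 impI)
    fix y assume y: "y \<in> space N" and eq: "(\<integral>x. q (x, y) \<partial>M) = (\<integral>x. q' (x, y) \<partial>M)"
    have "integrable M (\<lambda>x. q (x, y))" "integrable M (\<lambda>x. q' (x, y))"
      using y q_bounds q'_bounds by (auto intro!: M.integrable_const_bound[of _ 1] simp: space_pair_measure)
    then show "(\<integral>x. g (x, y) \<partial>M) = 0" using eq by (simp add: g_def)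
  qed
  \<comment> \<open>Each part of the score depends on one coordinate only. Integrating over the
    other coordinate first pulls it out of the inner integral, which is zero because the marginals
    agree.\<close>
  have "(\<integral>\<theta>. g \<theta> * f (fst \<theta>) \<partial>(M \<Otimes>\<^sub>M N)) = (\<integral>x. \<integral>y. g (x, y) * f x \<partial>N \<partial>M)"
    using MN.integral_fst'[OF gf] by simp
  also have "\<dots> = 0"
    using gM by (intro integral_eq_zero_AE) auto
  finally have int_gf: "(\<integral>\<theta>. g \<theta> * f (fst \<theta>) \<partial>(M \<Otimes>\<^sub>M N)) = 0" .
  have "(\<integral>\<theta>. g \<theta> * h (snd \<theta>) \<partial>(M \<Otimes>\<^sub>M N)) = (\<integral>y. \<integral>x. g (x, y) * h y \<partial>M \<partial>N)"
    using MN.integral_snd[of "\<lambda>x y. g (x, y) * h y"] gh by (simp add: case_prod_unfold)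
  also have "\<dots> = 0"
    using gN by (intro integral_eq_zero_AE) auto
  finally have int_gh: "(\<integral>\<theta>. g \<theta> * h (snd \<theta>) \<partial>(M \<Otimes>\<^sub>M N)) = 0" .
  have eq: "g \<theta> * (f (fst \<theta>) - h (snd \<theta>)) = g \<theta> * f (fst \<theta>) - g \<theta> * h (snd \<theta>)" for \<theta>
    by (simp add: algebra_simps)
  have int: "integrable (M \<Otimes>\<^sub>M N) (\<lambda>\<theta>. g \<theta> * (f (fst \<theta>) - h (snd \<theta>)))"
    unfolding eq using gf gh by simp
  have "(\<integral>\<theta>. g \<theta> * (f (fst \<theta>) - h (snd \<theta>)) \<partial>(M \<Otimes>\<^sub>M N)) = 0"
    unfolding eq using gf gh int_gf int_gh by simp
  moreover have "AE \<theta> in M \<Otimes>\<^sub>M N. 0 \<le> g \<theta> * (f (fst \<theta>) - h (snd \<theta>))"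
    using nonneg by (auto intro!: AE_I2 simp: space_pair_measure spaceN g_def)
  ultimately have zero: "AE \<theta> in M \<Otimes>\<^sub>M N. g \<theta> * (f (fst \<theta>) - h (snd \<theta>)) = 0"
    using integral_nonneg_eq_0_iff_AE[OF int] by blast
  \<comment> \<open>Since \<open>h\<close> is injective on \<open>T\<close>, at most one
    \<open>y\<close> solves \<open>h y = f x\<close>, and \<open>N\<close> has no atoms.\<close>
  have "AE y in N. f x - h y \<noteq> 0" for x
  proof -
    let ?Y = "{y \<in> T. h y = f x}"
    have "y = y'" if "y \<in> ?Y" "y' \<in> ?Y" for y y'
    proof (rule ccontr)
      assume "y \<noteq> y'"
      then have "\<sigma> * y < \<sigma> * y' \<or> \<sigma> * y' < \<sigma> * y"
        using \<sigma> by (metis linorder_neqE_linordered_idom mult_cancel_left)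
      then show False
        using strict_antimono_upper_measure[OF T, of y y' \<sigma>]
          strict_antimono_upper_measure[OF T, of y' y \<sigma>] that by (auto simp: h_eq)
    qed
    then have "countable ?Y"
      by (metis (no_types, lifting) countable_empty countable_insert is_singletonI' is_singleton_the_elem)
    then have "AE y in N. y \<notin> ?Y"
      by (rule AE_discrete_difference) (auto simp: null setsN sets_restrict_space_iff)
    then show ?thesis
      by (rule AE_mp) (auto simp: spaceN)
  qed
  \<comment> \<open>The exceptional set has null slices and is therefore null; off it, a vanishing
    product forces \<open>g\<close> to vanish.\<close>
  then have "AE \<theta> in M \<Otimes>\<^sub>M N. f (fst \<theta>) - h (snd \<theta>) \<noteq> 0"
    by (intro MN.AE_pair_measure) auto
  with zero show ?thesis
    by eventually_elim (simp add: g_def)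
qed

section \<open>Utility and incentive constraints for fixed reports\<close>

lemma pmf_alternative_2: "pmf (P :: alternative pmf) 2 = 1 - pmf P 1"
  using sum_pmf_eq_1[of UNIV P] by (simp add: sum_2)

text \<open>At a fixed report, utility is affine in the true type; transfers and the constants
  \<open>c\<close> do not affect the slope. After integration this slope becomes the
  subgradient.\<close>

lemma ex_post_utility_shift:
  "ex_post_utility a c p t i x \<theta> =
     ex_post_utility a c p t i r \<theta> + (x - r) * (a i 2 + (a i 1 - a i 2) * pmf (p \<theta>) 1)"
  by (simp add: ex_post_utility_def utility_def UNIV_2 pmf_alternative_2 algebra_simps)

text \<open>Add the constraints that \<open>x\<close> does not gain by reporting \<open>x'\<close>
  and conversely. The factor \<open>a i 1 - a i 2\<close> orders types by how strongly they favour
  alternative 1, which covers both of its signs.\<close>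

lemma DIC_allocation_mono:
  assumes "DIC \<Theta> a c p t" "x \<in> \<Theta> i" "x' \<in> \<Theta> i" "y \<in> \<Theta> (opponent i)"
    and "(a i 1 - a i 2) * x < (a i 1 - a i 2) * x'"
  shows "pmf (p (profile i x y)) 1 \<le> pmf (p (profile i x' y)) 1"
proof -
  let ?P = "\<lambda>x. pmf (p (profile i x y)) 1"
  have "ex_post_utility a c p t i x (profile i x' y) \<le> ex_post_utility a c p t i x (profile i x y)"
    "ex_post_utility a c p t i x' (profile i x y) \<le> ex_post_utility a c p t i x' (profile i x' y)"
    using assms by (auto simp: DIC_def)
  then have "0 \<le> ((a i 1 - a i 2) * x' - (a i 1 - a i 2) * x) * (?P x' - ?P x)"
    unfolding ex_post_utility_shift[of a c p t i x' _ x] by (simp add: algebra_simps)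
  then show ?thesis
    using assms(5) by (simp add: zero_le_mult_iff)
qed

section \<open>Interim utilities and interim allocations\<close>

definition interim_allocation ::
  "(agent \<Rightarrow> real set) \<Rightarrow> (agent \<Rightarrow> real measure) \<Rightarrow> allocation_rule \<Rightarrow> agent \<Rightarrow> real \<Rightarrow> real" where
  "interim_allocation \<Theta> G p i r =
     (\<integral>y. pmf (p (profile i r y)) 1 \<partial>type_dist \<Theta> G (opponent i))"

locale continuous_types =
  fixes \<Theta> :: "agent \<Rightarrow> real set" and G :: "agent \<Rightarrow> real measure"
  assumes compact_types: "\<And>i. compact (\<Theta> i)"
    and real_distribution_types: "\<And>i. real_distribution (G i)"
    and continuous_cdf_types: "\<And>i. continuous_on UNIV (cdf (G i))"
    and mass_types: "\<And>i. measure (G i) (\<Theta> i) = 1"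
begin

abbreviation "\<mu> \<equiv> type_dist \<Theta> G"

lemma types_borel [measurable]: "\<Theta> i \<in> sets borel"
  using compact_types by (simp add: borel_compact)

lemma sets_type_dist: "sets (\<mu> i) = sets (restrict_space borel (\<Theta> i))"
  using real_distribution.events_eq_borel[OF real_distribution_types]
  by (simp add: type_dist_def sets_restrict_space)

lemma space_type_dist: "space (\<mu> i) = \<Theta> i"
  using sets_eq_imp_space_eq[OF sets_type_dist] by (simp add: space_restrict_space)

lemma prob_space_type_dist: "prob_space (\<mu> i)"
proof -
  interpret real_distribution "G i" by (rule real_distribution_types)
  show ?thesis
    unfolding type_dist_def
    by (rule prob_space_restrict_space) (use mass_types[of i] in \<open>simp_all add: emeasure_eq_measure\<close>)
qed

text \<open>A jump of the cdf at \<open>x\<close> is exactly an atom at \<open>x\<close>, so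
  continuity excludes atoms.\<close>

lemma emeasure_type_dist_singleton:
  assumes "x \<in> \<Theta> i"
  shows "emeasure (\<mu> i) {x} = 0"
proof -
  interpret real_distribution "G i" by (rule real_distribution_types)
  have "isCont (cdf (G i)) x"
    using continuous_cdf_types[of i] by (simp add: continuous_on_eq_continuous_at)
  then show ?thesis
    using assms by (simp add: isCont_cdf type_dist_def emeasure_restrict_space emeasure_eq_measure)
qed

lemma AE_type_dist_not_in_countable:
  assumes "countable A" "A \<subseteq> \<Theta> i"
  shows "AE x in \<mu> i. x \<notin> A"
  using assms
  by (intro AE_discrete_difference)
    (auto simp: emeasure_type_dist_singleton sets_type_dist sets_restrict_space_iff)

lemma profile_measurable:
  assumes "r \<in> \<Theta> i"
  shows "profile i r \<in> measurable (\<mu> (opponent i)) (profile_dist \<Theta> G)"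
  using assms exhaust_2[of i] measurable_Pair1'[of r "\<mu> 1" "\<mu> 2"] measurable_Pair2'[of r "\<mu> 2" "\<mu> 1"]
  by (auto simp: profile_def[abs_def] opponent_def profile_dist_def space_type_dist)

lemma integrable_interim_allocation:
  assumes "mechanism \<Theta> G p t" "r \<in> \<Theta> i"
  shows "integrable (\<mu> (opponent i)) (\<lambda>y. pmf (p (profile i r y)) 1)"
proof -
  interpret prob_space "\<mu> (opponent i)" by (rule prob_space_type_dist)
  have "(\<lambda>y. pmf (p (profile i r y)) 1) \<in> borel_measurable (\<mu> (opponent i))"
    using assms by (intro measurable_compose[OF profile_measurable]) (auto simp: mechanism_def)
  then show ?thesis
    by (intro integrable_const_bound[of _ 1]) (auto simp: pmf_le_1)
qed

text \<open>Integrate \<open>ex_post_utility_shift\<close> over the opponent's type. The correction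
  term is bounded, so integrability for true type \<open>r\<close> carries over to every true
  type.\<close>

lemma interim_utility_shift:
  assumes "mechanism \<Theta> G p t" "r \<in> \<Theta> i" and ex: "interim_utility_exists \<Theta> G a c p t i r r"
  shows "interim_utility_exists \<Theta> G a c p t i x r"
    and "interim_utility \<Theta> G a c p t i x r = interim_utility \<Theta> G a c p t i r r +
      (x - r) * (a i 2 + (a i 1 - a i 2) * interim_allocation \<Theta> G p i r)"
proof -
  interpret prob_space "\<mu> (opponent i)" by (rule prob_space_type_dist)
  note int = integrable_interim_allocation[OF assms(1,2)] ex[unfolded interim_utility_exists_def]
  show "interim_utility_exists \<Theta> G a c p t i x r"
    unfolding interim_utility_exists_def ex_post_utility_shift[of a c p t i x _ r]
    using int by simp
  show "interim_utility \<Theta> G a c p t i x r = interim_utility \<Theta> G a c p t i r r +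
      (x - r) * (a i 2 + (a i 1 - a i 2) * interim_allocation \<Theta> G p i r)"
    unfolding interim_utility_def interim_allocation_def ex_post_utility_shift[of a c p t i x _ r]
    using int by (simp add: prob_space)
qed

text \<open>The ex-post inequalities integrate to interim ones. Existence of truthful interim
  utilities is assumed because DIC allows adding any function of the opponent's report to a
  transfer, integrable or not; payoff equivalence will supply it.\<close>

lemma DIC_imp_BIC:
  assumes "mechanism \<Theta> G p t" "DIC \<Theta> a c p t"
    and "\<And>i x. x \<in> \<Theta> i \<Longrightarrow> interim_utility_exists \<Theta> G a c p t i x x"
  shows "BIC \<Theta> G a c p t"
  unfolding BIC_def
proof (intro allI ballI conjI)
  fix i x r assume x: "x \<in> \<Theta> i" and r: "r \<in> \<Theta> i"
  show ex: "interim_utility_exists \<Theta> G a c p t i x r"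
    using interim_utility_shift(1) assms(1,3) r by blast
  show "interim_utility \<Theta> G a c p t i x r \<le> interim_utility \<Theta> G a c p t i x x"
    unfolding interim_utility_def
    using ex assms(2) assms(3)[OF x] x r
    by (intro integral_mono) (auto simp: interim_utility_exists_def DIC_def space_type_dist)
qed

text \<open>Expanding the utility of a misreport with \<open>interim_utility_shift\<close> turns BIC
  into a subgradient inequality for truthful interim utility. Both mechanisms share that function,
  so their slopes differ on a countable set only, and \<open>a i 1 \<noteq> a i 2\<close> recovers
  the allocation from the slope.\<close>

lemma BIC_interim_allocation_unique:
  assumes "mechanism \<Theta> G p t" "BIC \<Theta> G a c p t" "mechanism \<Theta> G p' t'" "BIC \<Theta> G a c p' t'"
    and eq: "\<And>x. x \<in> \<Theta> i \<Longrightarrow> interim_utility \<Theta> G a c p t i x x = interim_utility \<Theta> G a c p' t' i x x"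
    and "a i 1 \<noteq> a i 2"
  shows "AE x in \<mu> i. interim_allocation \<Theta> G p i x = interim_allocation \<Theta> G p' i x"
proof -
  let ?S = "\<lambda>p r. a i 2 + (a i 1 - a i 2) * interim_allocation \<Theta> G p i r"
  have sub: "interim_utility \<Theta> G a c p t i r r + (x - r) * ?S p r \<le> interim_utility \<Theta> G a c p t i x x"
    if "mechanism \<Theta> G p t" "BIC \<Theta> G a c p t" "x \<in> \<Theta> i" "r \<in> \<Theta> i" for p t x r
    using that interim_utility_shift(2)[OF that(1,4), of a c x] unfolding BIC_def by metis
  have "countable {x \<in> \<Theta> i. ?S p x \<noteq> ?S p' x}"
    by (rule countable_common_subgradients_differ[of _ "\<lambda>x. interim_utility \<Theta> G a c p t i x x"])
      (use sub[of p t] sub[of p' t'] assms(1-4) eq in auto)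
  then have "AE x in \<mu> i. x \<notin> {x \<in> \<Theta> i. ?S p x \<noteq> ?S p' x}"
    by (rule AE_type_dist_not_in_countable) auto
  then show ?thesis
    by (rule AE_mp) (use assms(6) in \<open>auto simp: space_type_dist\<close>)
qed

end

theorem proposition12:
  fixes \<Theta> :: "agent \<Rightarrow> real set"
    and G :: "agent \<Rightarrow> real measure"
    and a c :: "agent \<Rightarrow> alternative \<Rightarrow> real"
    and p p' :: allocation_rule
    and t t' :: transfer_rule
  assumes "\<And>i. compact (\<Theta> i)" and "\<And>i. is_interval (\<Theta> i)"
    and "\<And>i. real_distribution (G i)"
    and "\<And>i. continuous_on UNIV (cdf (G i))"
    and "\<And>i. measure (G i) (\<Theta> i) = 1"
    and "\<And>i. a i 1 \<noteq> a i 2"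
    and "mechanism \<Theta> G p t" and "BIC \<Theta> G a c p t"
    and "mechanism \<Theta> G p' t'" and "deterministic \<Theta> p'" and "DIC \<Theta> a c p' t'"
  shows "payoff_equivalent \<Theta> G a c p t p' t' \<longleftrightarrow> ex_post_equivalent \<Theta> G a c p t p' t'"
proof
  assume pe: "payoff_equivalent \<Theta> G a c p t p' t'"
  interpret continuous_types \<Theta> G
    by (rule continuous_types.intro) (fact assms)+
  have "BIC \<Theta> G a c p' t'"
    using pe by (intro DIC_imp_BIC assms) (auto simp: payoff_equivalent_def)
  then have marg: "AE x in \<mu> i. interim_allocation \<Theta> G p i x = interim_allocation \<Theta> G p' i x" for i
    using pe assms by (intro BIC_interim_allocation_unique) (auto simp: payoff_equivalent_def)
  have "AE \<theta> in \<mu> 1 \<Otimes>\<^sub>M \<mu> 2. pmf (p \<theta>) 1 = pmf (p' \<theta>) 1"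
  \<comment> \<open>For each type of agent 1, the allocation is a threshold rule in agent 2's type.
    The sign of \<open>\<sigma>\<close> tells whether higher or lower types of agent 2 lean towards
    alternative 1.\<close>
  proof (rule threshold_rule_determined_by_marginals[where T = "\<Theta> 2" and \<sigma> = "a 2 1 - a 2 2"])
    show "pmf (p' (x, y)) 1 \<in> {0, 1}" if "x \<in> space (\<mu> 1)" "y \<in> \<Theta> 2" for x y
    proof -
      obtain k where "p' (x, y) = return_pmf k"
        using assms(10) \<open>x \<in> space (\<mu> 1)\<close> \<open>y \<in> \<Theta> 2\<close> by (auto simp: deterministic_def space_type_dist)
      then show ?thesis by (simp add: indicator_def)
    qed
    show "pmf (p' (x, y)) 1 \<le> pmf (p' (x, z)) 1"
      if "x \<in> space (\<mu> 1)" "y \<in> \<Theta> 2" "z \<in> \<Theta> 2" "(a 2 1 - a 2 2) * y < (a 2 1 - a 2 2) * z" for x y z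
      using DIC_allocation_mono[OF assms(11), of y 2 z x] that
      by (simp add: profile_def opponent_def space_type_dist)
    show "AE x in \<mu> 1. (\<integral>y. pmf (p (x, y)) 1 \<partial>\<mu> 2) = (\<integral>y. pmf (p' (x, y)) 1 \<partial>\<mu> 2)"
      using marg[of 1] by (simp add: interim_allocation_def profile_def opponent_def)
    show "AE y in \<mu> 2. (\<integral>x. pmf (p (x, y)) 1 \<partial>\<mu> 1) = (\<integral>x. pmf (p' (x, y)) 1 \<partial>\<mu> 1)"
      using marg[of 2] by (simp add: interim_allocation_def profile_def opponent_def)
  qed (use assms in \<open>auto simp: prob_space_type_dist sets_type_dist emeasure_type_dist_singleton
      mechanism_def profile_dist_def pmf_le_1\<close>)
  then have "AE \<theta> in profile_dist \<Theta> G. \<forall>k. pmf (p \<theta>) k = pmf (p' \<theta>) k"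
    unfolding profile_dist_def by eventually_elim (simp add: forall_2 pmf_alternative_2)
  with pe show "ex_post_equivalent \<Theta> G a c p t p' t'"
    by (simp add: ex_post_equivalent_def)
qed (simp add: ex_post_equivalent_def)

end
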